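(* Let $\mathbf{O}$ be a decent class of operators. Then every locally uniformly $\mathbf{O}$-computable real function $\theta:D\to\mathbb{R}$ whose domain $D\subseteq\mathbb{R}^N$ is compact is uniformly $\mathbf{O}$-computable.
   Context: For $m\in\mathbb{N}$, $\mathbb{T}_m$ is the set of all total functions $\mathbb{N}^m\to\mathbb{N}$. For $k\in\mathbb{N}$, a $k$-ary operator is a mapping $\mathbb{T}_1^k\to\mathbb{T}_1$. For $c\in\mathbb{N}$, $\check{c}\in\mathbb{T}_1$ is the constant function with value $c$. A class $\mathbf{O}$ of operators is appropriate if: (1) for all $k$ and $i\in\{1,\ldots,k\}$ the operator $(f_1,\ldots,f_k)\mapsto f_i$ is in $\mathbf{O}$; (2) the operator $F(f_1,f_2)(n)=f_1(f_2(n))$ is in $\mathbf{O}$; (3) if $F$ is a $k$-ary operator in $\mathbf{O}$ and $G_1,\ldots,G_k$ are $l$-ary operators in $\mathbf{O}$, then $H(g_1,\ldots,g_l)=F(G_1(g_1,\ldots,g_l),\ldots,G_k(g_1,\ldots,g_l))$ is in $\mathbf{O}$; (4) if $F$ is a $(k+1)$-ary operator in $\mathbf{O}$, then $G(f_1,\ldots,f_k)(n)=F(f_1,\ldots,f_k,\check{n})(n)$ is in $\mathbf{O}$. For $f:\mathbb{N}^k\to\mathbb{N}$, $\mathring{f}(f_1,\ldots,f_k)(n)=f(f_1(n),\ldots,f_k(n))$; $f$ is $\mathbf{O}$-representable if $\mathring{f}\in\mathbf{O}$. The class $\mathbf{O}$ is decent if it is appropriate and the functions $\lambda x.x+1$,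 $\lambda xy.x\dotminus y$ (truncated subtraction) and $\delta_1$ are $\mathbf{O}$-representable, where $\delta_1(x,y,z)=y$ if $x=0$ and $z$ otherwise. A triple $(f,g,h)\in\mathbb{T}_1^3$ names $\xi\in\mathbb{R}$ if $\left|\frac{f(t)-g(t)}{h(t)+1}-\xi\right|<\frac{1}{t+1}$ for all $t$. A function $\theta:D\to\mathbb{R}$, $D\subseteq\mathbb{R}^N$, is uniformly $\mathbf{O}$-computable if there are $3N$-ary $F,G,H\in\mathbf{O}$ such that whenever $(\xi_1,\ldots,\xi_N)\in D$ and $(f_j,g_j,h_j)$ names $\xi_j$ ($j=1,\ldots,N$), the triple $(F(\bar f),G(\bar f),H(\bar f))$, with $\bar f=(f_1,g_1,h_1,\ldots,f_N,g_N,h_N)$, names $\theta(\xi_1,\ldots,\xi_N)$; it is locally uniformly $\mathbf{O}$-computable if every point of $D$ has a neighbourhood $U$ such that the restriction of $\theta$ to $D\cap U$ is uniformly $\mathbf{O}$-computable. *)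

theory Defs
  imports "HOL-Analysis.Analysis"
begin

text \<open>
  A tuple \<open>(f\<^sub>1, \<dots>, f\<^sub>k)\<close> of unary total functions is a list of length \<open>k\<close>, so \<open>f\<^sub>i\<close> is
  \<open>fs ! (i - 1)\<close>.  A \<open>k\<close>-ary operator is an extensional function on such tuples; this makes
  equality of operators coincide with equality of mappings on \<open>k\<close>-tuples.  Since a HOL function
  does not carry its domain, a class of operators is given by its \<open>k\<close>-ary members for each arity
  \<open>k \<ge> 0\<close>.
\<close>

type_synonym operator = "(nat \<Rightarrow> nat) list \<Rightarrow> (nat \<Rightarrow> nat)"

definition tuples :: "nat \<Rightarrow> (nat \<Rightarrow> nat) list set" where
  "tuples k = {fs. length fs = k}"

definition operators :: "nat \<Rightarrow> operator set" where
  "operators k = (tuples k \<rightarrow>\<^sub>E UNIV)"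

definition operator_class :: "(nat \<Rightarrow> operator set) \<Rightarrow> bool" where
  "operator_class \<O> \<longleftrightarrow> (\<forall>k. \<O> k \<subseteq> operators k)"

definition appropriate :: "(nat \<Rightarrow> operator set) \<Rightarrow> bool" where
  "appropriate \<O> \<longleftrightarrow>
     operator_class \<O> \<and>
     (\<forall>k. \<forall>i<k. (\<lambda>fs\<in>tuples k. fs ! i) \<in> \<O> k) \<and>
     (\<lambda>fs\<in>tuples 2. \<lambda>n. (fs ! 0) ((fs ! 1) n)) \<in> \<O> 2 \<and>
     (\<forall>k l. \<forall>F\<in>\<O> k. \<forall>Gs. length Gs = k \<and> set Gs \<subseteq> \<O> l \<longrightarrow>
        (\<lambda>gs\<in>tuples l. F (map (\<lambda>G. G gs) Gs)) \<in> \<O> l) \<and>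
     (\<forall>k. \<forall>F\<in>\<O> (k + 1). (\<lambda>fs\<in>tuples k. \<lambda>n. F (fs @ [\<lambda>_. n]) n) \<in> \<O> k)"

text \<open>
  A function \<open>\<nat>\<^sup>k \<rightarrow> \<nat>\<close> is a function on lists of naturals of which only the values on lists of
  length \<open>k\<close> matter.
\<close>

definition pointwise :: "nat \<Rightarrow> (nat list \<Rightarrow> nat) \<Rightarrow> operator" where
  "pointwise k f = (\<lambda>fs\<in>tuples k. \<lambda>n. f (map (\<lambda>g. g n) fs))"

definition representable :: "(nat \<Rightarrow> operator set) \<Rightarrow> nat \<Rightarrow> (nat list \<Rightarrow> nat) \<Rightarrow> bool" where
  "representable \<O> k f \<longleftrightarrow> pointwise k f \<in> \<O> k"

definition decent :: "(nat \<Rightarrow> operator set) \<Rightarrow> bool" where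
  "decent \<O> \<longleftrightarrow>
     appropriate \<O> \<and>
     representable \<O> 1 (\<lambda>xs. xs ! 0 + 1) \<and>
     representable \<O> 2 (\<lambda>xs. xs ! 0 - xs ! 1) \<and>
     representable \<O> 3 (\<lambda>xs. if xs ! 0 = 0 then xs ! 1 else xs ! 2)"

definition names :: "(nat \<Rightarrow> nat) \<Rightarrow> (nat \<Rightarrow> nat) \<Rightarrow> (nat \<Rightarrow> nat) \<Rightarrow> real \<Rightarrow> bool" where
  "names f g h \<xi> \<longleftrightarrow>
     (\<forall>t. \<bar>(real (f t) - real (g t)) / (real (h t) + 1) - \<xi>\<bar> < 1 / (real t + 1))"

text \<open>
  The space \<open>\<real>\<^sup>N\<close> is \<^term>\<open>Euclidean_space N\<close>, whose points are the sequences
  \<open>\<xi> :: nat \<Rightarrow> real\<close> with \<open>\<xi> j = 0\<close> for \<open>j \<ge> N\<close>; coordinates are numbered from \<open>0\<close>.  A real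
  function with domain \<open>D\<close> is a pair of \<open>D\<close> and a function whose values outside \<open>D\<close> are ignored,
  so its restriction to \<open>D \<inter> U\<close> is obtained by replacing \<open>D\<close> with \<open>D \<inter> U\<close>.
\<close>

definition uniformly_computable ::
    "(nat \<Rightarrow> operator set) \<Rightarrow> nat \<Rightarrow> (nat \<Rightarrow> real) set \<Rightarrow> ((nat \<Rightarrow> real) \<Rightarrow> real) \<Rightarrow> bool" where
  "uniformly_computable \<O> N D \<theta> \<longleftrightarrow>
     (\<exists>F\<in>\<O> (3 * N). \<exists>G\<in>\<O> (3 * N). \<exists>H\<in>\<O> (3 * N).
        \<forall>\<xi>\<in>D. \<forall>f g h. (\<forall>j<N. names (f j) (g j) (h j) (\<xi> j)) \<longrightarrow>
          (let fs = concat (map (\<lambda>j. [f j, g j, h j]) [0..<N])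
           in names (F fs) (G fs) (H fs) (\<theta> \<xi>)))"

definition locally_uniformly_computable ::
    "(nat \<Rightarrow> operator set) \<Rightarrow> nat \<Rightarrow> (nat \<Rightarrow> real) set \<Rightarrow> ((nat \<Rightarrow> real) \<Rightarrow> real) \<Rightarrow> bool" where
  "locally_uniformly_computable \<O> N D \<theta> \<longleftrightarrow>
     (\<forall>\<xi>\<in>D. \<exists>U V. openin (Euclidean_space N) V \<and> \<xi> \<in> V \<and> V \<subseteq> U \<and>
        uniformly_computable \<O> N (D \<inter> U) \<theta>)"

end

theory Submission imports Defs begin

text \<open>
  Around every point of the compact domain \<open>D\<close> a neighbourhood \<open>W\<close> is separated, by a test the class
  can perform on names, from the points outside a larger set on which \<open>\<theta>\<close> is uniformly computable.
  Finitely many \<open>W\<close> cover \<open>D\<close>, and the tests select a local algorithm that is correct at the given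
  point.  A test compares one sufficiently precise approximation \<open>(f t - g t) / (h t + 1)\<close> of each
  coordinate with fixed rational numbers.  Neither addition nor multiplication need be representable
  in a decent class, but the subtractive Euclidean algorithm, run on a fixed numerator and
  denominator, decides \<open>q * a \<le> p * b\<close> by truncated subtractions.
\<close>

section \<open>Definability in appropriate and decent classes\<close>

locale appropriate_class =
  fixes \<O> :: "nat \<Rightarrow> operator set"
  assumes appropriate: "appropriate \<O>"
begin

definition definable :: "nat \<Rightarrow> operator \<Rightarrow> bool" where
  "definable k A \<longleftrightarrow> restrict A (tuples k) \<in> \<O> k"

definition decidable :: "nat \<Rightarrow> ((nat \<Rightarrow> nat) list \<Rightarrow> nat \<Rightarrow> bool) \<Rightarrow> bool" where
  "decidable k P \<longleftrightarrow> definable k (\<lambda>fs n. if P fs n then 0 else 1)"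

lemma definable_if_mem:
  assumes "F \<in> \<O> k"
  shows "definable k F"
proof -
  have "F \<in> operators k"
    using assms appropriate unfolding appropriate_def operator_class_def by blast
  then have "restrict F (tuples k) = F"
    unfolding operators_def by (metis PiE_restrict)
  with assms show ?thesis
    unfolding definable_def by simp
qed

lemma definable_cong:
  assumes "definable k A" and "\<And>fs n. length fs = k \<Longrightarrow> A fs n = B fs n"
  shows "definable k B"
proof -
  have "restrict A (tuples k) = restrict B (tuples k)"
    using assms(2) by (intro restrict_ext ext) (simp add: tuples_def)
  with assms(1) show ?thesis
    by (simp add: definable_def)
qed

lemma definable_proj: "i < k \<Longrightarrow> definable k (\<lambda>fs. fs ! i)"
  using appropriate unfolding appropriate_def definable_def by blast

lemma definable_subst:
  assumes "definable (length As) F" and "\<And>A. A \<in> set As \<Longrightarrow> definable l A"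
  shows "definable l (\<lambda>gs. F (map (\<lambda>A. A gs) As))"
proof -
  define F' where "F' = restrict F (tuples (length As))"
  define Gs where "Gs = map (\<lambda>A. restrict A (tuples l)) As"
  have "F' \<in> \<O> (length As)" "set Gs \<subseteq> \<O> l" "length Gs = length As"
    using assms by (auto simp: F'_def Gs_def definable_def)
  then have "definable l (\<lambda>gs. F' (map (\<lambda>G. G gs) Gs))"
    using appropriate unfolding appropriate_def definable_def by blast
  then show ?thesis
    by (rule definable_cong) (simp add: F'_def Gs_def comp_def tuples_def)
qed

lemma definable_diagonal:
  assumes "definable (Suc k) A"
  shows "definable k (\<lambda>fs n. A (fs @ [\<lambda>_. n]) n)"
proof -
  have "definable k (\<lambda>fs n. restrict A (tuples (Suc k)) (fs @ [\<lambda>_. n]) n)"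
    using assms appropriate unfolding appropriate_def definable_def Suc_eq_plus1 by blast
  then show ?thesis
    by (rule definable_cong) (simp add: tuples_def)
qed

lemma definable_argument: "definable k (\<lambda>fs n. n)"
  using definable_diagonal[OF definable_proj[of k "Suc k"]]
  by (rule definable_cong) (auto simp: nth_append)

lemma definable_comp:
  assumes "definable k A" and "definable k B"
  shows "definable k (\<lambda>fs n. A fs (B fs n))"
proof -
  have "definable (length [A, B]) (\<lambda>fs n. (fs ! 0) ((fs ! 1) n))"
    using appropriate unfolding appropriate_def definable_def by (simp add: numeral_2_eq_2)
  from definable_subst[OF this, of k] show ?thesis
    using assms by auto
qed

lemma definable_representable:
  assumes "representable \<O> (length As) f" and "\<And>A. A \<in> set As \<Longrightarrow> definable k A"
  shows "definable k (\<lambda>fs n. f (map (\<lambda>A. A fs n) As))"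
proof -
  have "definable (length As) (\<lambda>fs n. f (map (\<lambda>g. g n) fs))"
    using assms(1) unfolding representable_def pointwise_def definable_def .
  from definable_subst[OF this assms(2)] show ?thesis
    by (simp add: comp_def)
qed

end

locale decent_class =
  fixes \<O> :: "nat \<Rightarrow> operator set"
  assumes decent: "decent \<O>"

sublocale decent_class \<subseteq> appropriate_class
  using decent by unfold_locales (simp add: decent_def)

context decent_class
begin

lemma definable_Suc:
  assumes "definable k A"
  shows "definable k (\<lambda>fs n. Suc (A fs n))"
  using definable_representable[of "[A]" "\<lambda>xs. xs ! 0 + 1" k] decent assms
  by (simp add: decent_def)

lemma definable_diff:
  assumes "definable k A" and "definable k B"
  shows "definable k (\<lambda>fs n. A fs n - B fs n)"
  using definable_representable[of "[A, B]" "\<lambda>xs. xs ! 0 - xs ! 1" k] decent assms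
  by (auto simp: decent_def numeral_2_eq_2)

lemma definable_const: "definable k (\<lambda>fs n. c)"
proof (induction c)
  case 0
  show ?case
    using definable_diff[OF definable_argument definable_argument] by simp
next
  case (Suc c)
  then show ?case
    by (rule definable_Suc)
qed

lemma definable_if_zero:
  assumes "definable k A" and "definable k B" and "definable k C"
  shows "definable k (\<lambda>fs n. if A fs n = 0 then B fs n else C fs n)"
  using definable_representable
      [of "[A, B, C]" "\<lambda>xs. if xs ! 0 = 0 then xs ! 1 else xs ! 2" k] decent assms
  by (auto simp: decent_def numeral_3_eq_3 numeral_2_eq_2 cong: if_cong)

lemma definable_if:
  assumes "decidable k P" and "definable k A" and "definable k B"
  shows "definable k (\<lambda>fs n. if P fs n then A fs n else B fs n)"
  using definable_if_zero[OF assms(1)[unfolded decidable_def] assms(2,3)]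
  by (rule definable_cong) simp

lemma decidable_const: "decidable k (\<lambda>fs n. b)"
  unfolding decidable_def by (rule definable_const)

lemma decidable_not:
  assumes "decidable k P"
  shows "decidable k (\<lambda>fs n. \<not> P fs n)"
  using definable_if[OF assms definable_const[of k 1] definable_const[of k 0]]
  unfolding decidable_def by (rule definable_cong) simp

lemma decidable_conj:
  assumes "decidable k P" and "decidable k Q"
  shows "decidable k (\<lambda>fs n. P fs n \<and> Q fs n)"
  using definable_if[OF assms(1) assms(2)[unfolded decidable_def] definable_const[of k 1]]
  unfolding decidable_def by (rule definable_cong) simp

lemma decidable_le:
  assumes "definable k A" and "definable k B"
  shows "decidable k (\<lambda>fs n. A fs n \<le> B fs n)"
  using definable_if_zero[OF definable_diff[OF assms] definable_const[of k 0]
      definable_const[of k 1]]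
  unfolding decidable_def by simp

end

section \<open>Comparison with rational numbers\<close>

lemma mult_le_mult_iff_diff_left:
  fixes a b p q :: nat
  assumes "q \<le> p"
  shows "q * a \<le> p * b \<longleftrightarrow> q * (a - b) \<le> (p - q) * b"
proof (cases "a \<le> b")
  case True
  with assms have "q * a \<le> p * b"
    by (simp add: mult_le_mono)
  with True show ?thesis
    by simp
next
  case False
  then show ?thesis
    using assms le_diff_iff[of "q * b" "q * a" "p * b"]
    by (simp add: diff_mult_distrib diff_mult_distrib2)
qed

lemma mult_le_mult_iff_diff_right:
  fixes a b p q :: nat
  assumes "p < q"
  shows "q * a \<le> p * b \<longleftrightarrow> (q - p) * a \<le> p * (b - a)"
proof (cases "a \<le> b")
  case True
  then show ?thesis
    using assms le_diff_iff[of "p * a" "q * a" "p * b"]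
    by (simp add: diff_mult_distrib diff_mult_distrib2)
next
  case False
  then have "p * b < q * a"
    using assms by (intro mult_strict_mono) auto
  with False assms show ?thesis
    by simp
qed

lemma of_nat_mult_diff_eq_max: "real (q * (a - b)) = max 0 (real q * (real a - real b))"
proof (cases "a \<le> b")
  case True
  then have "real q * (real a - real b) \<le> 0"
    by (simp add: mult_nonneg_nonpos)
  with True show ?thesis
    by simp
next
  case False
  then show ?thesis
    by (simp add: of_nat_diff)
qed

lemma diff_divide_le_iff:
  fixes a b c p q :: nat
  assumes "q > 0"
  shows "(real a - real b) / (real c + 1) \<le> real p / real q \<longleftrightarrow> q * (a - b) \<le> p * Suc c"
proof -
  have "(real a - real b) / (real c + 1) \<le> real p / real q \<longleftrightarrow>
      real q * (real a - real b) \<le> real (p * Suc c)"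
    using assms by (simp add: field_simps)
  also have "\<dots> \<longleftrightarrow> real (q * (a - b)) \<le> real (p * Suc c)"
    unfolding of_nat_mult_diff_eq_max by (simp only: max.bounded_iff of_nat_0_le_iff simp_thms)
  finally show ?thesis
    by (simp only: of_nat_le_iff)
qed

lemma le_diff_divide_iff:
  fixes a b c p q :: nat
  assumes "p > 0" and "q > 0"
  shows "real p / real q \<le> (real a - real b) / (real c + 1) \<longleftrightarrow> p * Suc c \<le> q * (a - b)"
proof -
  have "real (p * Suc c) > 0"
    using assms(1) by (simp only: of_nat_0_less_iff nat_0_less_mult_iff zero_less_Suc simp_thms)
  have "real p / real q \<le> (real a - real b) / (real c + 1) \<longleftrightarrow>
      real (p * Suc c) \<le> real q * (real a - real b)"
    using assms by (simp add: field_simps)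
  also have "\<dots> \<longleftrightarrow> real (p * Suc c) \<le> real (q * (a - b))"
    unfolding of_nat_mult_diff_eq_max using \<open>real (p * Suc c) > 0\<close> by linarith
  finally show ?thesis
    by (simp only: of_nat_le_iff)
qed

context decent_class
begin

lemma decidable_mult_le_mult:
  assumes "definable k A" and "definable k B"
  shows "decidable k (\<lambda>fs n. q * A fs n \<le> p * B fs n)"
  using assms
proof (induction "p + q" arbitrary: p q A B rule: less_induct)
  case less
  consider (q_zero) "q = 0" | (p_zero) "p = 0" "q > 0" | (reduce_p) "0 < q" "q \<le> p"
    | (reduce_q) "0 < p" "p < q"
    by linarith
  then show ?case
  proof cases
    case q_zero
    then show ?thesis
      by (simp add: decidable_const)
  next
    case p_zero
    with decidable_le[OF less.prems(1) definable_const[of k 0]] show ?thesis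
      by simp
  next
    case reduce_p
    then have "decidable k (\<lambda>fs n. q * (A fs n - B fs n) \<le> (p - q) * B fs n)"
      using less.prems by (intro less.hyps definable_diff) auto
    then show ?thesis
      using reduce_p by (simp add: mult_le_mult_iff_diff_left)
  next
    case reduce_q
    then have "decidable k (\<lambda>fs n. (q - p) * A fs n \<le> p * (B fs n - A fs n))"
      using less.prems by (intro less.hyps definable_diff) auto
    then show ?thesis
      using reduce_q by (simp add: mult_le_mult_iff_diff_right)
  qed
qed

lemma decidable_fraction_le_Rats:
  assumes "definable k A" and "definable k B" and "definable k C" and "r \<in> \<rat>"
  shows "decidable k (\<lambda>fs n. (real (A fs n) - real (B fs n)) / (real (C fs n) + 1) \<le> r)"
proof (cases "r \<ge> 0")
  case True
  with \<open>r \<in> \<rat>\<close> obtain p q :: nat where "q > 0" and r: "r = real p / real q"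
    by (metis Rats_abs_nat_div_natE abs_of_nonneg gr0I)
  have "decidable k (\<lambda>fs n. q * (A fs n - B fs n) \<le> p * Suc (C fs n))"
    using assms(1-3) by (intro decidable_mult_le_mult definable_diff definable_Suc)
  then show ?thesis
    unfolding r diff_divide_le_iff[OF \<open>q > 0\<close>] .
next
  case False
  with \<open>r \<in> \<rat>\<close> obtain p q :: nat where "q > 0" and r: "- r = real p / real q"
    by (metis Rats_abs_nat_div_natE abs_of_neg gr0I not_le)
  with False have "p > 0"
    by (auto intro: gr0I)
  have "(real a - real b) / (real c + 1) \<le> r \<longleftrightarrow>
      real p / real q \<le> (real b - real a) / (real c + 1)" for a b c
    using neg_le_iff_le[of r "(real a - real b) / (real c + 1)"]
    by (simp only: r minus_divide_left minus_diff_eq)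
  then have "(real a - real b) / (real c + 1) \<le> r \<longleftrightarrow> p * Suc c \<le> q * (b - a)" for a b c
    using le_diff_divide_iff[OF \<open>p > 0\<close> \<open>q > 0\<close>] by blast
  moreover have "decidable k (\<lambda>fs n. p * Suc (C fs n) \<le> q * (B fs n - A fs n))"
    using assms(1-3) by (intro decidable_mult_le_mult definable_diff definable_Suc)
  ultimately show ?thesis
    by simp
qed

end

section \<open>Boxes in Euclidean space\<close>

definition open_box :: "nat \<Rightarrow> (nat \<Rightarrow> real) \<Rightarrow> (nat \<Rightarrow> real) \<Rightarrow> (nat \<Rightarrow> real) set" where
  "open_box N c e = {\<xi> \<in> topspace (Euclidean_space N). \<forall>j<N. \<bar>\<xi> j - c j\<bar> < e j}"

lemma openin_open_box: "openin (Euclidean_space N) (open_box N c e)"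
proof -
  define S where "S j = (if j < N then ball (c j) (e j) else UNIV)" for j
  have "finite {j. S j \<noteq> UNIV}"
    by (rule finite_subset[of _ "{..<N}"]) (auto simp: S_def)
  then have "openin (powertop_real UNIV) (Pi\<^sub>E UNIV S)"
    by (simp add: openin_PiE_gen S_def)
  moreover have "open_box N c e = Pi\<^sub>E UNIV S \<inter> topspace (Euclidean_space N)"
    by (auto simp: open_box_def S_def PiE_iff dist_real_def abs_minus_commute split: if_splits)
  ultimately show ?thesis
    unfolding Euclidean_space_def by (auto simp: openin_subtopology)
qed

lemma openin_Euclidean_space_contains_open_box:
  assumes "openin (Euclidean_space N) V" and "c \<in> V"
  obtains e where "\<And>j. e j > 0" and "open_box N c e \<subseteq> V"
proof -
  obtain W where W: "openin (powertop_real UNIV) W" "V = W \<inter> topspace (Euclidean_space N)"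
    using assms(1) unfolding topspace_Euclidean_space
    by (auto simp: Euclidean_space_def openin_subtopology)
  with assms(2) obtain S where S: "\<And>j. open (S j)" "\<And>j. c j \<in> S j" "Pi\<^sub>E UNIV S \<subseteq> W"
    unfolding openin_product_topology_alt by (force simp: PiE_iff)
  have "\<exists>e>0. ball (c j) e \<subseteq> S j" for j
    using S(1,2) by (meson open_contains_ball)
  then obtain e where e: "\<And>j. e j > 0" "\<And>j. ball (c j) (e j) \<subseteq> S j"
    by metis
  have "\<xi> \<in> V" if "\<xi> \<in> open_box N c e" for \<xi>
  proof -
    from that have \<xi>: "\<xi> \<in> topspace (Euclidean_space N)" "\<forall>j<N. \<bar>\<xi> j - c j\<bar> < e j"
      by (auto simp: open_box_def)
    have "\<xi> j = c j" if "j \<ge> N" for j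
      using that \<xi>(1) assms(2) W(2) by (simp add: topspace_Euclidean_space)
    then have "\<xi> j \<in> ball (c j) (e j)" for j
      using \<xi>(2) e(1)[of j] by (cases "j < N") (auto simp: dist_real_def abs_minus_commute)
    then have "\<xi> j \<in> S j" for j
      using e(2)[of j] by (rule subsetD[rotated])
    then have "\<xi> \<in> Pi\<^sub>E UNIV S"
      by (simp add: PiE_iff)
    with S(3) W(2) \<xi>(1) show ?thesis
      by blast
  qed
  with e(1) that show ?thesis
    by blast
qed

section \<open>Names of points and separable sets\<close>

definition names_point :: "nat \<Rightarrow> (nat \<Rightarrow> nat) list \<Rightarrow> (nat \<Rightarrow> real) \<Rightarrow> bool" where
  "names_point N fs \<xi> \<longleftrightarrow>
     length fs = 3 * N \<and> (\<forall>j<N. names (fs ! (3 * j)) (fs ! (3 * j + 1)) (fs ! (3 * j + 2)) (\<xi> j))"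

lemma Suc_three_mult_div_mod:
  fixes j :: nat
  shows "Suc (3 * j) div 3 = j" and "Suc (3 * j) mod 3 = 1"
    and "Suc (Suc (3 * j)) div 3 = j" and "Suc (Suc (3 * j)) mod 3 = 2"
  by presburger+

lemma concat_map_triple:
  "concat (map (\<lambda>j. [f j, g j, h j]) [0..<N]) =
    map (\<lambda>i. [f (i div 3), g (i div 3), h (i div 3)] ! (i mod 3)) [0..<3 * N]"
proof (induction N)
  case (Suc N)
  have "3 * Suc N = Suc (Suc (Suc (3 * N)))"
    by simp
  then have "[0..<3 * Suc N] = [0..<3 * N] @ [3 * N, 3 * N + 1, 3 * N + 2]"
    by (simp only:) simp
  with Suc show ?case
    by (simp add: Suc_three_mult_div_mod del: mult_Suc_right)
qed simp

lemma names_point_iff_concat: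
  "names_point N fs \<xi> \<longleftrightarrow>
    (\<exists>f g h. fs = concat (map (\<lambda>j. [f j, g j, h j]) [0..<N]) \<and>
      (\<forall>j<N. names (f j) (g j) (h j) (\<xi> j)))"
  (is "_ \<longleftrightarrow> ?concat")
proof
  assume fs: "names_point N fs \<xi>"
  have "[fs ! (3 * j), fs ! (3 * j + 1), fs ! (3 * j + 2)] ! m = fs ! (3 * j + m)"
    if "m < 3" for j m
    using that by (auto simp: numeral_3_eq_3 less_Suc_eq)
  from this[of "_ mod 3" "_ div 3"]
  have "fs = concat (map (\<lambda>j. [fs ! (3 * j), fs ! (3 * j + 1), fs ! (3 * j + 2)]) [0..<N])"
    using fs unfolding concat_map_triple names_point_def by (simp add: list_eq_iff_nth_eq)
  moreover have "\<forall>j<N. names (fs ! (3 * j)) (fs ! (3 * j + 1)) (fs ! (3 * j + 2)) (\<xi> j)"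
    using fs by (simp add: names_point_def)
  ultimately show ?concat
    by (intro exI conjI)
next
  assume ?concat
  then show "names_point N fs \<xi>"
    unfolding names_point_def concat_map_triple by (auto simp: Suc_three_mult_div_mod)
qed

lemma uniformly_computable_iff_names_point:
  "uniformly_computable \<O> N D \<theta> \<longleftrightarrow>
    (\<exists>F\<in>\<O> (3 * N). \<exists>G\<in>\<O> (3 * N). \<exists>H\<in>\<O> (3 * N).
      \<forall>\<xi>\<in>D. \<forall>fs. names_point N fs \<xi> \<longrightarrow> names (F fs) (G fs) (H fs) (\<theta> \<xi>))"
  unfolding uniformly_computable_def names_point_iff_concat Let_def
  by (intro bex_cong ball_cong refl) blast

context appropriate_class
begin

lemma uniformly_computable_iff_definable:
  "uniformly_computable \<O> N D \<theta> \<longleftrightarrow>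
    (\<exists>F G H. definable (3 * N) F \<and> definable (3 * N) G \<and> definable (3 * N) H \<and>
      (\<forall>\<xi>\<in>D. \<forall>fs. names_point N fs \<xi> \<longrightarrow> names (F fs) (G fs) (H fs) (\<theta> \<xi>)))"
  (is "_ \<longleftrightarrow> ?definably_computable")
proof
  assume "uniformly_computable \<O> N D \<theta>"
  then show ?definably_computable
    unfolding uniformly_computable_iff_names_point by (blast intro: definable_if_mem)
next
  assume ?definably_computable
  then obtain F G H where "definable (3 * N) F" "definable (3 * N) G" "definable (3 * N) H"
    and "\<forall>\<xi>\<in>D. \<forall>fs. names_point N fs \<xi> \<longrightarrow> names (F fs) (G fs) (H fs) (\<theta> \<xi>)"
    by blast
  then show "uniformly_computable \<O> N D \<theta>"
    unfolding uniformly_computable_iff_names_point definable_def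
    by (intro bexI[of _ "restrict F (tuples (3 * N))"] bexI[of _ "restrict G (tuples (3 * N))"]
        bexI[of _ "restrict H (tuples (3 * N))"])
      (simp_all add: names_point_def tuples_def)
qed

definition separable :: "nat \<Rightarrow> (nat \<Rightarrow> real) set \<Rightarrow> (nat \<Rightarrow> real) set \<Rightarrow> bool" where
  "separable N A B \<longleftrightarrow>
     (\<exists>P. decidable (3 * N) P \<and>
       (\<forall>fs \<xi> n. names_point N fs \<xi> \<longrightarrow> (\<xi> \<in> A \<longrightarrow> P fs n) \<and> (\<xi> \<in> B \<longrightarrow> \<not> P fs n)))"

lemma separable_mono:
  assumes "separable N A B" and "A' \<subseteq> A" and "B' \<subseteq> B"
  shows "separable N A' B'"
  using assms unfolding separable_def by (meson subsetD)

end

context decent_class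
begin

lemma separable_sym:
  assumes "separable N A B"
  shows "separable N B A"
  using assms decidable_not unfolding separable_def by (metis (no_types, lifting))

lemma separable_UNIV_empty: "separable N UNIV {}"
  unfolding separable_def by (intro exI[of _ "\<lambda>fs n. True"]) (simp add: decidable_const)

lemma separable_Int_Un:
  assumes "separable N A B" and "separable N A' B'"
  shows "separable N (A \<inter> A') (B \<union> B')"
proof -
  obtain P P' where "decidable (3 * N) P" "decidable (3 * N) P'"
    and "\<forall>fs \<xi> n. names_point N fs \<xi> \<longrightarrow> (\<xi> \<in> A \<longrightarrow> P fs n) \<and> (\<xi> \<in> B \<longrightarrow> \<not> P fs n)"
    and "\<forall>fs \<xi> n. names_point N fs \<xi> \<longrightarrow> (\<xi> \<in> A' \<longrightarrow> P' fs n) \<and> (\<xi> \<in> B' \<longrightarrow> \<not> P' fs n)"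
    using assms unfolding separable_def by blast
  then show ?thesis
    unfolding separable_def
    by (intro exI[of _ "\<lambda>fs n. P fs n \<and> P' fs n"]) (auto intro: decidable_conj)
qed

lemma separable_INT_UN:
  assumes "finite I" and "\<And>i. i \<in> I \<Longrightarrow> separable N (A i) (B i)"
  shows "separable N (\<Inter>i\<in>I. A i) (\<Union>i\<in>I. B i)"
  using assms
proof (induction I rule: finite_induct)
  case empty
  show ?case
    by (simp add: separable_UNIV_empty)
next
  case (insert i I)
  then show ?case
    by (simp add: separable_Int_Un)
qed

lemma separable_halfspaces:
  assumes "j < N" and "a < b"
  shows "separable N {\<xi>. \<xi> j \<le> a} {\<xi>. b \<le> \<xi> j}"
proof -
  obtain t :: nat where t: "1 / (real t + 1) < (b - a) / 2"
    using nat_approx_posE[of "(b - a) / 2"] assms(2)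
    by (metis add.commute diff_gt_0_iff_gt half_gt_zero of_nat_Suc)
  then have "a + 1 / (real t + 1) < b - 1 / (real t + 1)"
    by argo
  then obtain r where "r \<in> \<rat>" and r: "a + 1 / (real t + 1) < r" "r < b - 1 / (real t + 1)"
    using Rats_dense_in_real by blast
  define approx where "approx fs = (real ((fs ! (3 * j)) t) - real ((fs ! (3 * j + 1)) t)) /
    (real ((fs ! (3 * j + 2)) t) + 1)" for fs :: "(nat \<Rightarrow> nat) list"
  have "definable (3 * N) (\<lambda>fs n. (fs ! i) t)" if "i < 3 * N" for i
    using definable_comp[OF definable_proj[OF that] definable_const] .
  then have "decidable (3 * N) (\<lambda>fs n. approx fs \<le> r)"
    unfolding approx_def using \<open>j < N\<close> \<open>r \<in> \<rat>\<close> by (intro decidable_fraction_le_Rats) auto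
  moreover have "\<bar>approx fs - \<xi> j\<bar> < 1 / (real t + 1)" if "names_point N fs \<xi>" for fs \<xi>
    using that \<open>j < N\<close> unfolding names_point_def names_def approx_def by blast
  then have "(\<xi> j \<le> a \<longrightarrow> approx fs \<le> r) \<and> (b \<le> \<xi> j \<longrightarrow> \<not> approx fs \<le> r)"
    if "names_point N fs \<xi>" for fs \<xi>
    using that r by (smt (verit))
  ultimately show ?thesis
    unfolding separable_def by (intro exI[of _ "\<lambda>fs n. approx fs \<le> r"]) auto
qed

lemma separable_slabs:
  fixes d e :: real
  assumes "j < N" and "d < e"
  shows "separable N {\<xi>. \<bar>\<xi> j - c\<bar> < d} {\<xi>. e \<le> \<bar>\<xi> j - c\<bar>}"
proof -
  have "separable N {\<xi>. \<xi> j \<le> c + d} {\<xi>. c + e \<le> \<xi> j}"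
    and "separable N {\<xi>. c - d \<le> \<xi> j} {\<xi>. \<xi> j \<le> c - e}"
    using assms by (auto intro!: separable_halfspaces intro: separable_sym)
  then have "separable N ({\<xi>. \<xi> j \<le> c + d} \<inter> {\<xi>. c - d \<le> \<xi> j})
      ({\<xi>. c + e \<le> \<xi> j} \<union> {\<xi>. \<xi> j \<le> c - e})"
    by (rule separable_Int_Un)
  then show ?thesis
    by (rule separable_mono) auto
qed

lemma separable_open_boxes:
  assumes "\<And>j. j < N \<Longrightarrow> d j < e j"
  shows "separable N (open_box N c d) (topspace (Euclidean_space N) - open_box N c e)"
proof -
  have "separable N (\<Inter>j\<in>{..<N}. {\<xi>. \<bar>\<xi> j - c j\<bar> < d j})
      (\<Union>j\<in>{..<N}. {\<xi>. e j \<le> \<bar>\<xi> j - c j\<bar>})"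
    using assms by (intro separable_INT_UN separable_slabs) auto
  then show ?thesis
    by (rule separable_mono) (auto simp: open_box_def not_less)
qed

lemma separable_neighbourhood:
  assumes "openin (Euclidean_space N) V" and "c \<in> V"
  obtains W where "openin (Euclidean_space N) W" and "c \<in> W"
    and "separable N W (topspace (Euclidean_space N) - V)"
proof -
  obtain e where e: "\<And>j. e j > 0" and "open_box N c e \<subseteq> V"
    using openin_Euclidean_space_contains_open_box[OF assms] by blast
  have "separable N (open_box N c (\<lambda>j. e j / 2)) (topspace (Euclidean_space N) - open_box N c e)"
    using e by (intro separable_open_boxes) simp
  then have "separable N (open_box N c (\<lambda>j. e j / 2)) (topspace (Euclidean_space N) - V)"
    by (rule separable_mono) (use \<open>open_box N c e \<subseteq> V\<close> in auto)
  moreover have "c \<in> open_box N c (\<lambda>j. e j / 2)"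
    using e openin_subset[OF assms(1)] assms(2) by (auto simp: open_box_def)
  ultimately show ?thesis
    using that openin_open_box by blast
qed

end

section \<open>Gluing local algorithms\<close>

context decent_class
begin

lemma locally_uniformly_computable_separable:
  assumes "locally_uniformly_computable \<O> N D \<theta>" and "D \<subseteq> topspace (Euclidean_space N)" and "c \<in> D"
  obtains W A where "openin (Euclidean_space N) W" and "c \<in> W"
    and "uniformly_computable \<O> N A \<theta>" and "separable N (D \<inter> W) (D - A)"
proof -
  obtain U V where V: "openin (Euclidean_space N) V" "c \<in> V" "V \<subseteq> U"
    and U: "uniformly_computable \<O> N (D \<inter> U) \<theta>"
    using assms(1,3) unfolding locally_uniformly_computable_def by blast
  obtain W where W: "openin (Euclidean_space N) W" "c \<in> W"
    and "separable N W (topspace (Euclidean_space N) - V)"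
    using separable_neighbourhood[OF V(1,2)] .
  from this(3) have "separable N (D \<inter> W) (D - D \<inter> U)"
    by (rule separable_mono) (use assms(2) V(3) in auto)
  with W U show ?thesis
    by (rule that)
qed

lemma uniformly_computable_empty: "uniformly_computable \<O> N {} \<theta>"
  using definable_const[of "3 * N" 0] unfolding uniformly_computable_iff_definable by blast

lemma uniformly_computable_if_separable:
  assumes "uniformly_computable \<O> N A \<theta>" and "uniformly_computable \<O> N B \<theta>"
    and "separable N (D - B) (D - A)"
  shows "uniformly_computable \<O> N D \<theta>"
proof -
  obtain F G H where FGH: "definable (3 * N) F" "definable (3 * N) G" "definable (3 * N) H"
    and names_A: "\<And>\<xi> fs. \<xi> \<in> A \<Longrightarrow> names_point N fs \<xi> \<Longrightarrow> names (F fs) (G fs) (H fs) (\<theta> \<xi>)"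
    using assms(1) unfolding uniformly_computable_iff_definable by blast
  obtain F' G' H' where FGH': "definable (3 * N) F'" "definable (3 * N) G'" "definable (3 * N) H'"
    and names_B: "\<And>\<xi> fs. \<xi> \<in> B \<Longrightarrow> names_point N fs \<xi> \<Longrightarrow> names (F' fs) (G' fs) (H' fs) (\<theta> \<xi>)"
    using assms(2) unfolding uniformly_computable_iff_definable by blast
  obtain P where P: "decidable (3 * N) P"
    and test: "\<And>\<xi> fs n. names_point N fs \<xi> \<Longrightarrow> (\<xi> \<in> D - B \<longrightarrow> P fs n) \<and> (\<xi> \<in> D - A \<longrightarrow> \<not> P fs n)"
    using assms(3) unfolding separable_def by blast
  let ?select = "\<lambda>F F' fs n. if P fs n then F fs n else F' fs n"
  have "names (?select F F' fs) (?select G G' fs) (?select H H' fs) (\<theta> \<xi>)"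
    if "\<xi> \<in> D" "names_point N fs \<xi>" for \<xi> fs
    unfolding names_def
  proof
    fix t
    have "if P fs t then \<xi> \<in> A else \<xi> \<in> B"
      using test that by auto
    then show "\<bar>(real (?select F F' fs t) - real (?select G G' fs t)) /
        (real (?select H H' fs t) + 1) - \<theta> \<xi>\<bar> < 1 / (real t + 1)"
      using names_A[OF _ that(2)] names_B[OF _ that(2)]
      by (cases "P fs t") (simp_all add: names_def)
  qed
  then show ?thesis
    unfolding uniformly_computable_iff_definable
    using definable_if[OF P FGH(1) FGH'(1)] definable_if[OF P FGH(2) FGH'(2)]
      definable_if[OF P FGH(3) FGH'(3)]
    by (intro exI[of _ "?select F F'"] exI[of _ "?select G G'"] exI[of _ "?select H H'"]) simp
qed

lemma uniformly_computable_finite_Union: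
  assumes "finite \<W>"
    and "\<And>W. W \<in> \<W> \<Longrightarrow> \<exists>A. uniformly_computable \<O> N A \<theta> \<and> separable N (D \<inter> W) (D - A)"
  shows "uniformly_computable \<O> N (D \<inter> \<Union>\<W>) \<theta>"
  using assms
proof (induction \<W> rule: finite_induct)
  case empty
  show ?case
    by (simp add: uniformly_computable_empty)
next
  case (insert W \<W>)
  then have "uniformly_computable \<O> N (D \<inter> \<Union>\<W>) \<theta>"
    by blast
  moreover obtain A where "uniformly_computable \<O> N A \<theta>" and "separable N (D \<inter> W) (D - A)"
    using insert.prems by blast
  moreover from this(2)
  have "separable N (D \<inter> \<Union>(insert W \<W>) - D \<inter> \<Union>\<W>) (D \<inter> \<Union>(insert W \<W>) - A)"
    by (rule separable_mono) auto
  ultimately show ?case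
    using uniformly_computable_if_separable by blast
qed

end

theorem theorem3:
  fixes \<O> :: "nat \<Rightarrow> operator set"
    and N :: nat
    and D :: "(nat \<Rightarrow> real) set"
    and \<theta> :: "(nat \<Rightarrow> real) \<Rightarrow> real"
  assumes "decent \<O>"
    and "D \<subseteq> topspace (Euclidean_space N)"
    and "compactin (Euclidean_space N) D"
    and "locally_uniformly_computable \<O> N D \<theta>"
  shows "uniformly_computable \<O> N D \<theta>"
proof -
  interpret decent_class \<O>
    using assms(1) by unfold_locales
  define \<G> where "\<G> = {W. openin (Euclidean_space N) W \<and>
    (\<exists>A. uniformly_computable \<O> N A \<theta> \<and> separable N (D \<inter> W) (D - A))}"
  have "D \<subseteq> \<Union>\<G>"
    unfolding \<G>_def using assms(2,4) by (blast elim: locally_uniformly_computable_separable)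
  moreover have "\<forall>W\<in>\<G>. openin (Euclidean_space N) W"
    by (simp add: \<G>_def)
  ultimately obtain \<W> where \<W>: "finite \<W>" "\<W> \<subseteq> \<G>" "D \<subseteq> \<Union>\<W>"
    using assms(3) unfolding compactin_def by meson
  then have "uniformly_computable \<O> N (D \<inter> \<Union>\<W>) \<theta>"
    by (intro uniformly_computable_finite_Union) (auto simp: \<G>_def)
  with \<W>(3) show ?thesis
    by (simp add: inf.absorb1)
qed

end
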